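(* Let $F$ be a supertropical semifield and let $V=(V,\mathcal H_0)$ be a supertropical vector space over $F$. The s-base of $V$, if it exists, is unique up to multiplication by scalars: if $S$ and $S'$ are s-bases of $V$, then there are a bijection $\varphi:S\to S'$ and nonzero scalars $\alpha_s\in F$ ($s\in S$) such that $\varphi(s)=\alpha_s s$ for all $s\in S$.
   Context: A semiring with ghosts is a triple $(R,\mathcal G_0,\nu)$ where $R$ is a semiring with $0,1$ such that $R\setminus\{0\}$ is closed under addition and multiplication, $\mathcal G_0\ni 0$ is an ideal (the ghost ideal), and $\nu:R\to\mathcal G_0$, $\nu(a)=a+a=:a^\nu$, is idempotent and preserves addition and multiplication. Put $e=1^\nu$, $\mathcal G=\mathcal G_0\setminus\{0\}$. It is a supertropical semiring if for nonzero $a,b$: $a+b=a^\nu$ whenever $a^\nu=b^\nu$, and $a+b\in\{a,b\}$ whenever $a^\nu\neq b^\nu$. It is a supertropical domain if $\mathcal T:=R\setminus\mathcal G_0$ (the tangible elements) is a multiplicative monoid and $\nu|_{\mathcal T}:\mathcal T\to\mathcal G$ is onto, and a supertropical semifield if moreover $\mathcal T$ is a group. A supertropical vector space over a supertropical semifield $F$ is a pair $(V,\mathcal H_0)$ where $V$ is an $F$-module (commutative additive monoid with zero $0_V$ and scalar multiplication satisfying the usual module axioms over a semiring, including $r0_V=0_V$ and $0v=0_V$) and $\mathcal H_0\supseteq eV$ is a submodule (the ghost submodule), such that, with $v^\nu:=v+v=ev$, $v^\nu=w^\nu$ implies $v+w=v^\nu$. Write $v\models_{gs}w$ ("$v$ ghost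 surpasses $w$") if $v=w+h$ for some $h\in\mathcal H_0$. A vector $v$ is tropically spanned by $S\subset V$ if $v\models_{gs}\sum_{i\in I'}\alpha_iw_i$ for some finite (possibly empty, with empty sum $0_V$) collection of elements $w_i\in S$ and $\alpha_i\in\mathcal T$. $S$ tropically spans $V$ if every $v\in V$ is tropically spanned by $S$. An s-base of $V$ is a subset $S$ of $V$ that tropically spans $V$ and such that no proper subset of $S$ tropically spans $V$. *)

theory Defs
  imports Main
begin

text \<open>
  Semirings are not assumed commutative, and the ghost ideal is two-sided. The class
  \<^class>\<open>semiring_1\<close> contains the law 0 \<open>\<noteq>\<close> 1; this costs nothing for supertropical
  domains, where 1 is tangible and 0 is ghost.
\<close>

locale semiring_with_ghosts =
  fixes G0 :: "'f::semiring_1 set"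
    and \<nu> :: "'f \<Rightarrow> 'f"
  assumes nonzero_add: "a \<noteq> 0 \<Longrightarrow> b \<noteq> 0 \<Longrightarrow> a + b \<noteq> 0"
    and nonzero_mult: "a \<noteq> 0 \<Longrightarrow> b \<noteq> 0 \<Longrightarrow> a * b \<noteq> 0"
    and ghost_zero: "0 \<in> G0"
    and ghost_add: "a \<in> G0 \<Longrightarrow> b \<in> G0 \<Longrightarrow> a + b \<in> G0"
    and ghost_mult_left: "a \<in> G0 \<Longrightarrow> r * a \<in> G0"
    and ghost_mult_right: "a \<in> G0 \<Longrightarrow> a * r \<in> G0"
    and nu_ghost: "\<nu> a \<in> G0"
    and nu_eq: "\<nu> a = a + a"
    and nu_idem: "\<nu> (\<nu> a) = \<nu> a"
    and nu_add: "\<nu> (a + b) = \<nu> a + \<nu> b"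
    and nu_mult: "\<nu> (a * b) = \<nu> a * \<nu> b"

locale supertropical_semiring = semiring_with_ghosts +
  assumes add_nu_eq: "a \<noteq> 0 \<Longrightarrow> b \<noteq> 0 \<Longrightarrow> \<nu> a = \<nu> b \<Longrightarrow> a + b = \<nu> a"
    and add_nu_neq: "a \<noteq> 0 \<Longrightarrow> b \<noteq> 0 \<Longrightarrow> \<nu> a \<noteq> \<nu> b \<Longrightarrow> a + b \<in> {a, b}"

definition tangibles :: "'f set \<Rightarrow> 'f set"
  where "tangibles G0 = UNIV - G0"

locale supertropical_domain = supertropical_semiring +
  assumes tangible_one: "1 \<in> tangibles G0"
    and tangible_mult: "a \<in> tangibles G0 \<Longrightarrow> b \<in> tangibles G0 \<Longrightarrow> a * b \<in> tangibles G0"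
    and nu_onto: "\<nu> ` tangibles G0 = G0 - {0}"

locale supertropical_semifield = supertropical_domain +
  assumes tangible_inverse:
    "a \<in> tangibles G0 \<Longrightarrow> \<exists>b \<in> tangibles G0. a * b = 1 \<and> b * a = 1"

text \<open>
  Modules over a semiring: the \<open>module\<close> locale of the library requires a commutative ring
  acting on an abelian group, so it does not apply.
\<close>

locale semimodule =
  fixes scale :: "'f::semiring_1 \<Rightarrow> 'v::comm_monoid_add \<Rightarrow> 'v"
  assumes scale_add_right: "scale r (v + w) = scale r v + scale r w"
    and scale_add_left: "scale (r + s) v = scale r v + scale s v"
    and scale_scale: "scale r (scale s v) = scale (r * s) v"
    and scale_one: "scale 1 v = v"
    and scale_zero_right: "scale r 0 = 0"
    and scale_zero_left: "scale 0 v = 0"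

locale supertropical_vector_space =
  supertropical_semifield G0 \<nu> + semimodule scale
  for G0 :: "'f::semiring_1 set"
    and \<nu> :: "'f \<Rightarrow> 'f"
    and scale :: "'f \<Rightarrow> 'v::comm_monoid_add \<Rightarrow> 'v" +
  fixes H0 :: "'v set"
  assumes ghost_vec_zero: "0 \<in> H0"
    and ghost_vec_add: "v \<in> H0 \<Longrightarrow> w \<in> H0 \<Longrightarrow> v + w \<in> H0"
    and ghost_vec_scale: "v \<in> H0 \<Longrightarrow> scale r v \<in> H0"
    and ghost_vec_nu: "scale (\<nu> 1) v \<in> H0"
    and vec_add_nu_eq: "v + v = w + w \<Longrightarrow> v + w = v + v"

definition ghost_surpasses :: "'v::comm_monoid_add set \<Rightarrow> 'v \<Rightarrow> 'v \<Rightarrow> bool"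
  where "ghost_surpasses H0 v w \<longleftrightarrow> (\<exists>h \<in> H0. v = w + h)"

text \<open>
  The combination runs over distinct vectors. Repetitions would add nothing: a sum of
  tangibles is tangible or ghost, and a ghost multiple of a vector lies in H0.
\<close>

definition tropically_spanned ::
    "'f::semiring_1 set \<Rightarrow> ('f \<Rightarrow> 'v::comm_monoid_add \<Rightarrow> 'v) \<Rightarrow> 'v set \<Rightarrow> 'v set \<Rightarrow> 'v \<Rightarrow> bool"
  where "tropically_spanned G0 scale H0 S v \<longleftrightarrow>
    (\<exists>W \<alpha>. finite W \<and> W \<subseteq> S \<and> (\<forall>w \<in> W. \<alpha> w \<in> tangibles G0) \<and>
           ghost_surpasses H0 v (\<Sum>w \<in> W. scale (\<alpha> w) w))"

definition tropically_spans ::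
    "'f::semiring_1 set \<Rightarrow> ('f \<Rightarrow> 'v::comm_monoid_add \<Rightarrow> 'v) \<Rightarrow> 'v set \<Rightarrow> 'v set \<Rightarrow> bool"
  where "tropically_spans G0 scale H0 S \<longleftrightarrow> (\<forall>v. tropically_spanned G0 scale H0 S v)"

definition s_base ::
    "'f::semiring_1 set \<Rightarrow> ('f \<Rightarrow> 'v::comm_monoid_add \<Rightarrow> 'v) \<Rightarrow> 'v set \<Rightarrow> 'v set \<Rightarrow> bool"
  where "s_base G0 scale H0 S \<longleftrightarrow>
    tropically_spans G0 scale H0 S \<and> (\<forall>S'. S' \<subset> S \<longrightarrow> \<not> tropically_spans G0 scale H0 S')"

end

theory Submission
  imports Defs
begin

text \<open>
  Let \<open>s\<close> belong to an s-base \<open>S\<close>, and let \<open>S'\<close> be another s-base. Expanding \<open>s\<close> in \<open>S'\<close> and then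
  every vector of \<open>S'\<close> that occurs in \<open>S\<close> gives \<open>s = c s + y\<close>, where \<open>y\<close> is tropically spanned
  by \<open>S - {s}\<close> and \<open>c\<close> is the sum of the products \<open>\<alpha>\<^sub>j \<beta>\<^sub>j\<close> of the coefficients along the
  routes from \<open>s\<close> through \<open>s'\<^sub>j\<close> back to \<open>s\<close>.

  The self-reference can be broken unless \<open>c\<close> is \<open>\<nu>\<close>-equivalent to \<open>1\<close>, that is, \<open>\<nu> c = \<nu> 1\<close>. If \<open>c\<close> is dominated by
  \<open>1\<close>, then \<open>c s\<close> may be replaced by its ghost, and if \<open>c\<close> dominates \<open>1\<close>, then \<open>c s\<close> already is a
  ghost; either way \<open>s\<close> would be tropically spanned by \<open>S - {s}\<close>, against minimality
  (lemma \<open>self_reference\<close>). So \<open>\<nu> c = \<nu> 1\<close>. A sum in \<open>F\<close> is \<open>\<nu>\<close>-equivalent to one of its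
  terms, whence \<open>\<nu> (\<alpha>\<^sub>j \<beta>\<^sub>j) = \<nu> 1\<close> for a single \<open>j\<close>: one vector \<open>s'\<^sub>j\<close> carries all of \<open>s\<close>.
  Then \<open>s = \<alpha>\<^sub>j s'\<^sub>j + x\<close> and \<open>\<alpha>\<^sub>j s'\<^sub>j = \<alpha>\<^sub>j \<beta>\<^sub>j s + w\<close>, and such mutual domination forces
  \<open>s = \<alpha>\<^sub>j s'\<^sub>j\<close> exactly (lemma \<open>mutual_domination\<close>).

  Thus each vector of either base is a tangible multiple of a vector of the other. Distinct
  vectors of one s-base are never multiples of each other, so this correspondence is a
  bijection.

  Unlike in \<open>F\<close>, a sum of two vectors need not be one of them or its ghost, so vectors cannot be
  compared case by case. The arguments about vectors rest instead on the idempotence of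
  doubling and on \<open>v + w = v + v\<close> for \<open>v + v = w + w\<close>.
\<close>

section \<open>Scalars and ghost vectors\<close>

context supertropical_vector_space
begin

lemma zero_not_tangible: "a \<in> tangibles G0 \<Longrightarrow> a \<noteq> 0"
  using ghost_zero by (auto simp: tangibles_def)

lemma scale_sum_right: "scale r (sum f W) = (\<Sum>w\<in>W. scale r (f w))"
  by (induction W rule: infinite_finite_induct)
    (simp_all add: scale_add_right scale_zero_right)

lemma scale_sum_left: "scale (sum f W) v = (\<Sum>w\<in>W. scale (f w) v)"
  by (induction W rule: infinite_finite_induct)
    (simp_all add: scale_add_left scale_zero_left)

lemma scale_double: "scale (a + a) v = scale a (v + v)"
  by (simp add: scale_add_left scale_add_right)

lemma double_idem: "v + v + (v + v) = v + (v :: 'v)"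
proof -
  have "(1 + 1) + (1 + 1) = (1 + 1 :: 'f)"
    using nu_idem[of 1] by (simp only: nu_eq)
  then have "scale ((1 + 1) + (1 + 1)) v = scale (1 + 1) v" by (rule arg_cong)
  then show ?thesis by (simp only: scale_add_left scale_one)
qed

lemma double_absorbs: "v + v + v = v + (v :: 'v)"
proof -
  have "(v + v) + v = (v + v) + (v + v)"
    by (rule vec_add_nu_eq) (rule double_idem)
  then show ?thesis by (simp only: double_idem)
qed

lemma double_ghost: "v + v \<in> H0"
  using ghost_vec_nu[of v] by (simp only: nu_eq scale_add_left scale_one)

text \<open>Every nonzero ghost scalar is a double, because \<open>\<nu>\<close> maps the tangibles onto these.\<close>

lemma scale_ghost:
  assumes "a \<in> G0"
  shows "scale a v \<in> H0"
proof (cases "a = 0")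
  case True
  then show ?thesis by (simp add: scale_zero_left ghost_vec_zero)
next
  case False
  then obtain b where "a = \<nu> b" using assms nu_onto by blast
  then show ?thesis
    by (simp add: nu_eq scale_add_left double_ghost)
qed

lemma sum_in_H0: "(\<And>w. w \<in> W \<Longrightarrow> f w \<in> H0) \<Longrightarrow> sum f W \<in> H0"
  by (induction W rule: infinite_finite_induct)
    (simp_all add: ghost_vec_zero ghost_vec_add)

lemma nu_zero_neq_one: "\<nu> 0 \<noteq> \<nu> 1"
  using nonzero_add[of 1 1] by (simp add: nu_eq)

lemma nu_equiv_scale:
  assumes "\<nu> c = \<nu> 1"
  shows "scale c (v + v) = v + v"
proof -
  have "scale (c + c) v = scale (1 + 1) v" using assms by (simp only: nu_eq)
  then show ?thesis by (simp only: scale_double scale_one)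
qed

text \<open>Addition of scalars returns, up to \<open>\<nu>\<close>, one of the summands.\<close>

lemma nu_sum_eq_one:
  assumes "finite W" and "\<nu> (sum f W) = \<nu> 1"
  shows "\<exists>w\<in>W. \<nu> (f w) = \<nu> 1"
  using assms
proof (induction W)
  case empty
  then show ?case using nu_zero_neq_one by simp
next
  case (insert x W)
  have "\<nu> (f x + sum f W) \<in> {\<nu> (f x), \<nu> (sum f W)}"
  proof (cases "f x = 0 \<or> sum f W = 0 \<or> \<nu> (f x) \<noteq> \<nu> (sum f W)")
    case True
    then show ?thesis
      using add_nu_neq[of "f x" "sum f W"] by (cases "f x = 0 \<or> sum f W = 0") auto
  next
    case False
    then show ?thesis using add_nu_eq[of "f x" "sum f W"] by (auto simp: nu_idem)
  qed
  then show ?case using insert by auto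
qed

section \<open>Vectors that dominate themselves\<close>

text \<open>
  A vector with \<open>s = c s + y\<close> can be freed from the reference to itself, at the cost of a ghost,
  unless \<open>c\<close> is \<open>\<nu>\<close>-equivalent to \<open>1\<close>. The proof compares \<open>c\<close> with \<open>1\<close> through \<open>c + 1\<close>.
\<close>

lemma self_reference:
  assumes s: "s = scale c s + y" and c: "\<nu> c \<noteq> \<nu> 1"
  shows "\<exists>h\<in>H0. s = y + h"
proof -
  consider "c = 0" | "c + 1 = 1" | "c + 1 = c"
    using add_nu_neq[of c 1] c by fastforce
  then show ?thesis
  proof cases
    case 1
    then have "s = y + 0" using s by (simp add: scale_zero_left)
    then show ?thesis using ghost_vec_zero by blast
  next
    case 2
    let ?u = "scale c s"
    have "?u + s = s"
      using arg_cong[OF 2, of "\<lambda>r. scale r s"] by (simp add: scale_add_left scale_one)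
    \<comment> \<open>Adding \<open>c s\<close> twice to \<open>s\<close> changes nothing, but turns the summand \<open>c s\<close> of \<open>s\<close> into its ghost.\<close>
    then have "s = (?u + ?u) + (?u + y)" using s by (simp add: add.assoc)
    also have "\<dots> = (?u + ?u + ?u) + y" by (simp add: add.assoc)
    also have "\<dots> = y + (?u + ?u)" by (simp only: double_absorbs add.commute[of _ y])
    finally show ?thesis using double_ghost by blast
  next
    case 3
    let ?u = "scale c s"
    have us: "?u + s = ?u"
      using arg_cong[OF 3, of "\<lambda>r. scale r s"] by (simp add: scale_add_left scale_one)
    \<comment> \<open>\<open>s\<close> is above \<open>c s\<close> by hypothesis and below it by dominance, so they are \<open>\<nu>\<close>-equivalent.\<close>
    have "?u + ?u = (?u + s) + (?u + s)" by (simp only: us)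
    also have "\<dots> = (?u + ?u) + (s + s)" by (simp add: ac_simps)
    also have "\<dots> = (?u + ?u) + ((?u + y) + (?u + y))" using s by simp
    also have "\<dots> = (?u + ?u + (?u + ?u)) + (y + y)" by (simp only: ac_simps)
    also have "\<dots> = (?u + ?u) + (y + y)" by (simp only: double_idem)
    also have "\<dots> = (?u + y) + (?u + y)" by (simp only: ac_simps)
    also have "\<dots> = s + s" using s by simp
    finally have "?u + s = ?u + ?u" by (rule vec_add_nu_eq)
    then have "?u \<in> H0" using us double_ghost by metis
    moreover have "s = y + ?u" using s by (simp add: add.commute)
    ultimately show ?thesis by blast
  qed
qed

text \<open>
  Here substituting \<open>s = c s + y\<close> into itself turns \<open>y\<close> into the ghost \<open>c y + y = y + y\<close>. One more
  substitution absorbs the remaining tangible copy of \<open>y\<close>, which leaves no difference between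
  \<open>s\<close> and \<open>c s\<close>.
\<close>

lemma nu_equiv_self_reference:
  assumes s: "s = scale c s + y" and c: "\<nu> c = \<nu> 1"
  shows "scale c s = s" and "s + (y + y) = s"
proof -
  let ?g = "y + y"
  have cg: "scale c ?g = ?g" using c by (rule nu_equiv_scale)
  have cs: "scale c s = scale c (scale c s) + scale c y"
    using arg_cong[OF s, of "scale c"] by (simp only: scale_add_right)
  have "scale c y + y = scale c y + scale c y"
    using cg by (intro vec_add_nu_eq) (simp add: scale_add_right)
  then have cy: "scale c y + y = ?g"
    using cg by (simp add: scale_add_right)
  have s2: "s = scale c (scale c s) + ?g"
    using s cs cy by (metis add.assoc)
  then have cs3: "scale c s = scale c (scale c (scale c s)) + ?g"
    using cg by (metis scale_add_right)
  have "s = (scale c (scale c (scale c s)) + ?g) + y" using s cs3 by simp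
  also have "\<dots> = scale c (scale c (scale c s)) + ?g"
    by (simp only: add.assoc[of _ ?g y] double_absorbs)
  finally show *: "scale c s = s" using cs3 by simp
  show "s + ?g = s" using s2 * by simp
qed

text \<open>
  Each of \<open>s\<close> and \<open>t\<close> contains the other as a summand, up to a factor \<open>\<nu>\<close>-equivalent to \<open>1\<close>.
  Eliminating \<open>t\<close> makes \<open>s\<close> refer to itself, so \<open>s\<close> absorbs \<open>w + w\<close>; it then absorbs \<open>w\<close> too,
  although \<open>w\<close> is only part of the remainder.
\<close>

lemma mutual_domination:
  assumes s: "s = t + x" and t: "t = scale c s + w" and c: "\<nu> c = \<nu> 1"
  shows "s = t"
proof -
  have "s = scale c s + (w + x)" using s t by (simp add: add.assoc)
  note self = nu_equiv_self_reference[OF this c]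
  have s': "s = s + (w + w) + (x + x)" using self(2) by (simp add: ac_simps)
  have "s + w = s + (w + w + w) + (x + x)" using s' by (metis add.assoc add.commute)
  also have "\<dots> = s" using s' by (simp only: double_absorbs)
  finally show ?thesis using t self(1) by simp
qed

section \<open>The tropical span\<close>

abbreviation spanned :: "'v set \<Rightarrow> 'v \<Rightarrow> bool"
  where "spanned \<equiv> tropically_spanned G0 scale H0"

text \<open>
  Coefficients may be arbitrary scalars, since the terms with a ghost coefficient can be moved into
  the ghost summand. This makes the closure properties of the span easy.
\<close>

lemma spannedI:
  assumes "finite W" "W \<subseteq> S" "h \<in> H0" and v: "v = (\<Sum>w\<in>W. scale (\<alpha> w) w) + h"
  shows "spanned S v"
proof -
  let ?T = "{w\<in>W. \<alpha> w \<in> tangibles G0}"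
  have ghost: "(\<Sum>w\<in>W - ?T. scale (\<alpha> w) w) \<in> H0"
    by (rule sum_in_H0) (simp add: tangibles_def scale_ghost)
  have "(\<Sum>w\<in>W. scale (\<alpha> w) w) =
      (\<Sum>w\<in>W - ?T. scale (\<alpha> w) w) + (\<Sum>w\<in>?T. scale (\<alpha> w) w)"
    using assms(1) by (intro sum.subset_diff) auto
  then have "v = (\<Sum>w\<in>?T. scale (\<alpha> w) w) + ((\<Sum>w\<in>W - ?T. scale (\<alpha> w) w) + h)"
    using v by (simp add: ac_simps)
  then have "ghost_surpasses H0 v (\<Sum>w\<in>?T. scale (\<alpha> w) w)"
    unfolding ghost_surpasses_def using ghost_vec_add[OF ghost assms(3)] by blast
  moreover have "finite ?T" "?T \<subseteq> S" using assms(1,2) by auto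
  ultimately show ?thesis unfolding tropically_spanned_def by blast
qed

lemma spannedE:
  assumes "spanned S v"
  obtains W \<alpha> h where "finite W" "W \<subseteq> S" "\<And>w. w \<in> W \<Longrightarrow> \<alpha> w \<in> tangibles G0" "h \<in> H0"
    "v = (\<Sum>w\<in>W. scale (\<alpha> w) w) + h"
  using assms unfolding tropically_spanned_def ghost_surpasses_def by blast

lemma spanned_ghost: "h \<in> H0 \<Longrightarrow> spanned S h"
  by (rule spannedI[of "{}"]) auto

lemma spanned_base: "s \<in> S \<Longrightarrow> spanned S s"
  by (rule spannedI[of "{s}" _ 0 _ "\<lambda>_. 1"]) (auto simp: scale_one ghost_vec_zero)

lemma spanned_scale:
  assumes "spanned S v"
  shows "spanned S (scale r v)"
proof -
  obtain W \<alpha> h where W: "finite W" "W \<subseteq> S" "h \<in> H0"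
    and v: "v = (\<Sum>w\<in>W. scale (\<alpha> w) w) + h"
    using assms by (rule spannedE) blast
  have "scale r v = (\<Sum>w\<in>W. scale (r * \<alpha> w) w) + scale r h"
    by (simp add: v scale_add_right scale_sum_right scale_scale)
  then show ?thesis using W ghost_vec_scale by (intro spannedI)
qed

lemma spanned_add:
  assumes "spanned S u" "spanned S v"
  shows "spanned S (u + v)"
proof -
  obtain U \<alpha> g where U: "finite U" "U \<subseteq> S" "g \<in> H0"
    and u: "u = (\<Sum>w\<in>U. scale (\<alpha> w) w) + g"
    using assms(1) by (rule spannedE) blast
  obtain W \<beta> h where W: "finite W" "W \<subseteq> S" "h \<in> H0"
    and v: "v = (\<Sum>w\<in>W. scale (\<beta> w) w) + h"
    using assms(2) by (rule spannedE) blast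
  let ?\<alpha> = "\<lambda>w. if w \<in> U then \<alpha> w else 0" and ?\<beta> = "\<lambda>w. if w \<in> W then \<beta> w else 0"
  have "(\<Sum>w\<in>U. scale (\<alpha> w) w) = (\<Sum>w\<in>U \<union> W. scale (?\<alpha> w) w)"
    by (rule sum.mono_neutral_cong_left) (auto simp: U W scale_zero_left)
  moreover have "(\<Sum>w\<in>W. scale (\<beta> w) w) = (\<Sum>w\<in>U \<union> W. scale (?\<beta> w) w)"
    by (rule sum.mono_neutral_cong_left) (auto simp: U W scale_zero_left)
  ultimately have "u + v = (\<Sum>w\<in>U \<union> W. scale (?\<alpha> w + ?\<beta> w) w) + (g + h)"
    unfolding u v by (simp only: scale_add_left sum.distrib ac_simps)
  then show ?thesis using U W ghost_vec_add by (intro spannedI[of "U \<union> W"]) auto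
qed

lemma spanned_sum: "(\<And>w. w \<in> W \<Longrightarrow> spanned S (f w)) \<Longrightarrow> spanned S (sum f W)"
  by (induction W rule: infinite_finite_induct)
    (simp_all add: spanned_add spanned_ghost ghost_vec_zero)

lemma spanned_trans:
  assumes "spanned S v" and "\<And>s. s \<in> S \<Longrightarrow> spanned S' s"
  shows "spanned S' v"
proof -
  obtain W \<alpha> h where "W \<subseteq> S" "h \<in> H0" "v = (\<Sum>w\<in>W. scale (\<alpha> w) w) + h"
    using assms(1) by (rule spannedE) blast
  then show ?thesis
    using assms(2) by (blast intro: spanned_add spanned_sum spanned_scale spanned_ghost)
qed

lemma spanned_split:
  assumes "spanned S v"
  shows "\<exists>c y. v = scale c s + y \<and> spanned (S - {s}) y"
proof -
  obtain W \<alpha> h where W: "finite W" "W \<subseteq> S" "h \<in> H0"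
    and v: "v = (\<Sum>w\<in>W. scale (\<alpha> w) w) + h"
    using assms by (rule spannedE) blast
  let ?y = "(\<Sum>w\<in>W - {s}. scale (\<alpha> w) w) + h"
  have y: "spanned (S - {s}) ?y"
    using W by (intro spannedI[of "W - {s}"]) auto
  show ?thesis
  proof (cases "s \<in> W")
    case True
    then have "v = scale (\<alpha> s) s + ?y"
      using W(1) by (simp add: v sum.remove add.assoc)
    then show ?thesis using y by blast
  next
    case False
    then have "v = scale 0 s + ?y" by (simp add: v scale_zero_left)
    then show ?thesis using y by blast
  qed
qed

section \<open>Comparing two s-bases\<close>

text \<open>
  Minimality speaks of the whole space; it becomes a condition on one vector because \<open>S - {s}\<close>
  spans everything as soon as it spans \<open>s\<close>.
\<close>

lemma s_base_independent:
  assumes "s_base G0 scale H0 S" "s \<in> S"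
  shows "\<not> spanned (S - {s}) s"
proof
  assume "spanned (S - {s}) s"
  then have "spanned (S - {s}) t" if "t \<in> S" for t
    using that spanned_base[of t "S - {s}"] by (cases "t = s") auto
  moreover have "spanned S v" for v
    using assms(1) by (simp add: s_base_def tropically_spans_def)
  ultimately have "tropically_spans G0 scale H0 (S - {s})"
    unfolding tropically_spans_def using spanned_trans by blast
  moreover have "S - {s} \<subset> S" using assms(2) by blast
  ultimately show False using assms(1) by (simp add: s_base_def)
qed

lemma s_base_not_multiple:
  assumes "s_base G0 scale H0 S" "s \<in> S" "t \<in> S" "s = scale r t"
  shows "s = t"
proof (rule ccontr)
  assume "s \<noteq> t"
  then have "spanned (S - {s}) (scale r t)"
    using assms(3) by (intro spanned_scale spanned_base) simp
  then show False using assms s_base_independent by simp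
qed

text \<open>
  This is the heart of the uniqueness: \<open>s\<close> is expanded in \<open>S'\<close> and back in \<open>S\<close>. The coefficient
  with which \<open>s\<close> recurs in total must be \<open>\<nu>\<close>-equivalent to \<open>1\<close> by independence of \<open>S\<close>, and so
  the recurrence through a single vector of \<open>S'\<close> already has such a coefficient.
\<close>

lemma s_base_element_multiple:
  assumes S: "s_base G0 scale H0 S" and S': "tropically_spans G0 scale H0 S'" and "s \<in> S"
  shows "\<exists>s'\<in>S'. \<exists>a\<in>tangibles G0. s = scale a s'"
proof -
  have "spanned S' s" using S' by (simp add: tropically_spans_def)
  then obtain W \<alpha> h where W: "finite W" "W \<subseteq> S'" "\<And>w. w \<in> W \<Longrightarrow> \<alpha> w \<in> tangibles G0" "h \<in> H0"
    and s: "s = (\<Sum>w\<in>W. scale (\<alpha> w) w) + h"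
    by (rule spannedE) blast
  have "\<exists>c y. v = scale c s + y \<and> spanned (S - {s}) y" for v
    using S by (intro spanned_split) (simp add: s_base_def tropically_spans_def)
  then obtain \<beta> z where z: "\<And>v. v = scale (\<beta> v) s + z v" "\<And>v. spanned (S - {s}) (z v)"
    by metis
  let ?c = "\<Sum>w\<in>W. \<alpha> w * \<beta> w" and ?y = "(\<Sum>w\<in>W. scale (\<alpha> w) (z w)) + h"
  have expand: "scale (\<alpha> w) w = scale (\<alpha> w * \<beta> w) s + scale (\<alpha> w) (z w)" for w
    using arg_cong[OF z(1), of "scale (\<alpha> w)" w] by (simp only: scale_add_right scale_scale)
  have "(\<Sum>w\<in>W. scale (\<alpha> w) w) =
      (\<Sum>w\<in>W. scale (\<alpha> w * \<beta> w) s + scale (\<alpha> w) (z w))"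
    by (rule sum.cong[OF refl expand])
  then have self: "s = scale ?c s + ?y"
    by (intro trans[OF s]) (simp only: sum.distrib scale_sum_left add.assoc)
  have y: "spanned (S - {s}) ?y"
    by (intro spanned_add spanned_sum spanned_scale spanned_ghost z(2) W(4))
  have "\<nu> ?c = \<nu> 1"
  proof (rule ccontr)
    assume "\<nu> ?c \<noteq> \<nu> 1"
    then obtain g where g: "g \<in> H0" "s = ?y + g" using self_reference[OF self] by blast
    then have "spanned (S - {s}) s" using spanned_add[OF y spanned_ghost] by metis
    then show False using s_base_independent[OF S \<open>s \<in> S\<close>] by blast
  qed
  then obtain w where w: "w \<in> W" "\<nu> (\<alpha> w * \<beta> w) = \<nu> 1"
    using nu_sum_eq_one[OF W(1)] by blast
  have "s = scale (\<alpha> w) w + ((\<Sum>w\<in>W - {w}. scale (\<alpha> w) w) + h)"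
    using s W(1) w(1) by (simp add: sum.remove add.assoc)
  then have "s = scale (\<alpha> w) w"
    by (rule mutual_domination[OF _ expand w(2)])
  then show ?thesis using w(1) W(2,3) by blast
qed

end

theorem theorem5p25:
  fixes G0 :: "'f::semiring_1 set"
    and \<nu> :: "'f \<Rightarrow> 'f"
    and scale :: "'f \<Rightarrow> 'v::comm_monoid_add \<Rightarrow> 'v"
    and H0 S S' :: "'v set"
  assumes "supertropical_vector_space G0 \<nu> scale H0"
    and "s_base G0 scale H0 S"
    and "s_base G0 scale H0 S'"
  shows "\<exists>\<phi> \<alpha>. bij_betw \<phi> S S' \<and> (\<forall>s \<in> S. \<alpha> s \<noteq> (0::'f) \<and> \<phi> s = scale (\<alpha> s) s)"
proof -
  interpret supertropical_vector_space G0 \<nu> scale H0 by (rule assms(1))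
  have spans: "tropically_spans G0 scale H0 S" "tropically_spans G0 scale H0 S'"
    using assms(2,3) by (auto simp: s_base_def)
  have "\<exists>s'\<in>S'. \<exists>a b. a \<noteq> 0 \<and> s' = scale a s \<and> s = scale b s'" if s: "s \<in> S" for s
  proof -
    obtain s' b where s': "s' \<in> S'" "b \<in> tangibles G0" "s = scale b s'"
      using s_base_element_multiple[OF assms(2) spans(2) s] by blast
    obtain a where a: "a \<in> tangibles G0" "a * b = 1" using tangible_inverse[OF s'(2)] by blast
    have "s' = scale a s" using a(2) s'(3) by (simp add: scale_scale scale_one)
    then show ?thesis using s' a(1) zero_not_tangible by blast
  qed
  then obtain \<phi> \<alpha> \<beta> where *: "\<And>s. s \<in> S \<Longrightarrow>
      \<phi> s \<in> S' \<and> \<alpha> s \<noteq> 0 \<and> \<phi> s = scale (\<alpha> s) s \<and> s = scale (\<beta> s) (\<phi> s)"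
    by metis
  have "inj_on \<phi> S"
  proof (rule inj_onI)
    fix s t assume st: "s \<in> S" "t \<in> S" "\<phi> s = \<phi> t"
    have "s = scale (\<beta> s) (scale (\<alpha> t) t)" using * st by metis
    then have "s = scale (\<beta> s * \<alpha> t) t" by (simp only: scale_scale)
    then show "s = t" by (rule s_base_not_multiple[OF assms(2) st(1,2)])
  qed
  moreover have "\<phi> ` S = S'"
  proof
    show "\<phi> ` S \<subseteq> S'" using * by blast
    show "S' \<subseteq> \<phi> ` S"
    proof
      fix s' assume s': "s' \<in> S'"
      obtain s c where s: "s \<in> S" "s' = scale c s"
        using s_base_element_multiple[OF assms(3) spans(1) s'] by blast
      have "s' = scale c (scale (\<beta> s) (\<phi> s))" using * s by metis
      then have "s' = scale (c * \<beta> s) (\<phi> s)" by (simp only: scale_scale)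
      then have "s' = \<phi> s"
        using s_base_not_multiple[OF assms(3) s'] * s(1) by blast
      then show "s' \<in> \<phi> ` S" using s(1) by blast
    qed
  qed
  ultimately have "bij_betw \<phi> S S'" by (simp add: bij_betw_def)
  then show ?thesis using * by blast
qed

end
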